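(* Let $q$ be an odd prime power. For all $u,v\in\mathbb{F}_q$ with $u\neq v$ and all integers $n\ge 2$, $$|C_{u,v}(n)|-|D_{u,v}(n)|=\begin{cases}0, & \text{if } 2\nmid n,\\ |C_{u,v}(n/2)|, & \text{if } 2\mid n.\end{cases}$$
   Context: $\mathcal{I}_q^n$ denotes the set of monic irreducible polynomials of degree $n$ in $\mathbb{F}_q[x]$. For $a\in\mathbb{F}_q$ write $\left(\frac{a}{q}\right)=a^{(q-1)/2}$, which for $a\neq 0$ equals $1$ if $a$ is a square in $\mathbb{F}_q^{\ast}$ and $-1$ otherwise (and equals $0$ for $a=0$). For $n\ge 1$, $$C_{u,v}(n):=\left\{f\in\mathcal{I}_q^n\;\middle|\; \left(\tfrac{f(u)f(v)}{q}\right)=-1\right\},$$ and for $n\ge 2$, $D_{u,v}(n):=\mathcal{I}_q^n\setminus C_{u,v}(n)=\left\{f\in\mathcal{I}_q^n\mid \left(\tfrac{f(u)f(v)}{q}\right)=1\right\}$. *)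

theory Defs
  imports
    "HOL-Computational_Algebra.Computational_Algebra"
    "HOL-Library.Cardinality"
begin

text \<open>
  The field with \<open>q\<close> elements is a type of class \<open>finite_field\<close> and \<open>q\<close> is its cardinality, which
  is automatically a prime power.
\<close>

text \<open>
  The quadratic symbol \<open>a ^ ((q - 1) / 2)\<close>; its values \<open>0\<close>, \<open>1\<close>, \<open>-1\<close> are elements of the field
  itself. It is meant for odd \<open>q\<close>, where \<open>1 \<noteq> -1\<close> and the division is exact.
\<close>
definition quad_symbol :: "'a::finite_field \<Rightarrow> 'a" where
  "quad_symbol a = a ^ ((CARD('a) - 1) div 2)"

definition monic_irreducibles :: "nat \<Rightarrow> 'a::finite_field poly set" where
  "monic_irreducibles n = {f. irreducible f \<and> lead_coeff f = 1 \<and> degree f = n}"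

definition C_set :: "'a::finite_field \<Rightarrow> 'a \<Rightarrow> nat \<Rightarrow> 'a poly set" where
  "C_set u v n = {f \<in> monic_irreducibles n. quad_symbol (poly f u * poly f v) = -1}"

definition D_set :: "'a::finite_field \<Rightarrow> 'a \<Rightarrow> nat \<Rightarrow> 'a poly set" where
  "D_set u v n = monic_irreducibles n - C_set u v n"

lemma finite_monic_irreducibles: "finite (monic_irreducibles n :: 'a::finite_field poly set)"
proof (rule finite_subset)
  show "monic_irreducibles n \<subseteq> (Poly ` {xs :: 'a list. set xs \<subseteq> UNIV \<and> length xs = Suc n})"
  proof
    fix f :: "'a poly" assume "f \<in> monic_irreducibles n"
    hence "irreducible f" "degree f = n" by (auto simp: monic_irreducibles_def)
    hence "f \<noteq> 0" by auto
    hence "length (coeffs f) = Suc n" using \<open>degree f = n\<close> by (simp add: length_coeffs_degree)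
    thus "f \<in> Poly ` {xs :: 'a list. set xs \<subseteq> UNIV \<and> length xs = Suc n}"
      by (intro image_eqI[of _ _ "coeffs f"]) auto
  qed
  show "finite (Poly ` {xs :: 'a list. set xs \<subseteq> UNIV \<and> length xs = Suc n})"
    by (intro finite_imageI finite_lists_length_eq) auto
qed

lemma monic_irreducibles_no_root:
  fixes f :: "'a::finite_field poly"
  assumes "f \<in> monic_irreducibles n" "n \<ge> 2"
  shows "poly f a \<noteq> 0"
proof
  assume "poly f a = 0"
  then obtain g where g: "f = [:-a, 1:] * g" by (auto simp: poly_eq_0_iff_dvd)
  have irr: "irreducible f" and deg: "degree f = n" and nz: "f \<noteq> 0"
    using assms by (auto simp: monic_irreducibles_def)
  have "g \<noteq> 0" using g nz by auto
  hence "degree f = 1 + degree g" unfolding g by (subst degree_mult_eq) auto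
  hence "degree g \<noteq> 0" using deg assms(2) by simp
  moreover have "[:-a, 1:] dvd 1 \<or> g dvd 1"
    using irr g by (blast dest: irreducibleD)
  ultimately show False using \<open>g \<noteq> 0\<close> by (auto simp: is_unit_iff_degree)
qed

lemma quad_symbol_cases:
  fixes a :: "'a::finite_field"
  assumes "odd (CARD('a))" "a \<noteq> 0"
  shows "quad_symbol a = 1 \<or> quad_symbol a = -1"
proof -
  have "(CARD('a) - 1) div 2 * 2 = CARD('a) - 1" using assms(1) by simp
  hence "quad_symbol a ^ 2 = a ^ (CARD('a) - 1)"
    unfolding quad_symbol_def by (metis power_mult)
  also have "a * a ^ (CARD('a) - 1) = a"
    using finite_field_power_card_eq_same[of a] assms(1)
    by (metis odd_pos power_minus_mult mult.commute)
  hence "a ^ (CARD('a) - 1) = 1" using assms(2) by simp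
  finally show ?thesis by (simp add: power2_eq_1_iff)
qed

lemma one_neq_minus_one:
  assumes "odd (CARD('a::finite_field))"
  shows "(1::'a) \<noteq> -1"
proof
  assume "(1::'a) = -1"
  hence two: "(x::'a) + x = 0" for x
    by (metis add.right_inverse distrib_left mult.right_neutral mult_zero_right)
  have "even (card S)" if "finite S" "\<And>x. x \<in> S \<Longrightarrow> x + 1 \<in> S" for S :: "'a set"
    using that
  proof (induction "card S" arbitrary: S rule: less_induct)
    case less
    show ?case
    proof (cases "S = {}")
      case False
      then obtain x where x: "x \<in> S" by auto
      have x1: "x + 1 \<in> S" "x + 1 \<noteq> x" using less.prems x by auto
      have card: "card S = card (S - {x, x + 1}) + 2"
        using x x1 less.prems(1) card_Diff_subset[of "{x, x + 1}" S] card_mono[of S "{x, x + 1}"]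
        by auto
      have "even (card (S - {x, x + 1}))"
      proof (rule less.hyps)
        fix y assume y: "y \<in> S - {x, x + 1}"
        have "y + 1 + 1 = y" using two[of 1] by (simp add: add.assoc)
        thus "y + 1 \<in> S - {x, x + 1}" using y less.prems(2)[of y] by auto
      qed (use card less.prems in auto)
      thus ?thesis using card by simp
    qed auto
  qed
  from this[of UNIV] assms show False by auto
qed

lemma D_set_eq:
  fixes u v :: "'a::finite_field"
  assumes "odd (CARD('a))" "n \<ge> 2"
  shows "D_set u v n = {f \<in> monic_irreducibles n. quad_symbol (poly f u * poly f v) = 1}"
proof -
  have "quad_symbol (poly f u * poly f v) \<noteq> -1 \<longleftrightarrow> quad_symbol (poly f u * poly f v) = 1"
    if "f \<in> monic_irreducibles n" for f
    using quad_symbol_cases[OF assms(1), of "poly f u * poly f v"] one_neq_minus_one[OF assms(1)]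
      monic_irreducibles_no_root[OF that assms(2)] by auto
  thus ?thesis by (auto simp: D_set_def C_set_def)
qed

end

theory Submission
  imports Defs
begin

text \<open>
  Let \<open>\<chi>\<close> be the quadratic character of \<open>\<FF>\<^sub>q\<close> with integer values. The function
  \<open>F \<mapsto> \<chi> (F(u) F(v))\<close> is completely multiplicative, and its sums \<open>S\<^sub>n\<close> over the monic
  polynomials of degree \<open>n\<close> are \<open>S\<^sub>0 = 1\<close>, \<open>S\<^sub>1 = -1\<close>, and \<open>S\<^sub>n = 0\<close> for \<open>n \<ge> 2\<close>; its
  \<open>L\<close>-function is thus \<open>1 - t\<close>. Comparing logarithmic derivatives of the Euler product gives
  \<open>\<Sum>\<^bsub>d|n\<^esub> d (B\<^sub>d + (-1)\<^bsup>n/d\<^esup> C\<^sub>d) = -1\<close> for all \<open>n \<ge> 1\<close>, where \<open>B\<^sub>d\<close> and \<open>C\<^sub>d\<close> count the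
  irreducibles of degree \<open>d\<close> with value \<open>1\<close> and \<open>-1\<close>. This is equivalent to
  \<open>B\<^sub>d - C\<^sub>d + [2|d] C\<^bsub>d/2\<^esub> + [d=1] = 0\<close> for all \<open>d\<close>.
\<close>

section \<open>Sums over monic polynomials\<close>

definition monics :: "nat \<Rightarrow> 'a::finite_field poly set" where
  "monics n = {f. lead_coeff f = 1 \<and> degree f = n}"

lemma monicsD:
  assumes "F \<in> monics n"
  shows "F \<noteq> 0" "lead_coeff F = 1" "degree F = n"
  using assms by (auto simp: monics_def)

lemma monic_irreducibles_subset_monics: "monic_irreducibles n \<subseteq> monics n"
  by (auto simp: monic_irreducibles_def monics_def)

lemma finite_monics [simp]: "finite (monics n :: 'a::finite_field poly set)"
proof (rule finite_subset)
  show "monics n \<subseteq> Poly ` {xs :: 'a list. set xs \<subseteq> UNIV \<and> length xs = Suc n}"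
  proof
    fix f :: "'a poly" assume f: "f \<in> monics n"
    hence "length (coeffs f) = Suc n"
      using monicsD[OF f] by (simp add: length_coeffs_degree)
    thus "f \<in> Poly ` {xs :: 'a list. set xs \<subseteq> UNIV \<and> length xs = Suc n}"
      by (intro image_eqI[of _ _ "coeffs f"]) auto
  qed
  show "finite (Poly ` {xs :: 'a list. set xs \<subseteq> UNIV \<and> length xs = Suc n})"
    by (intro finite_imageI finite_lists_length_eq) auto
qed

lemma monics_0: "monics 0 = {1 :: 'a::finite_field poly}"
  by (auto simp: monics_def elim!: degree_eq_zeroE)

lemma monics_1: "monics 1 = range (\<lambda>a :: 'a::finite_field. [:-a, 1:])"
proof (intro equalityI subsetI)
  fix f :: "'a poly" assume "f \<in> monics 1"
  hence f: "degree f = 1" "coeff f 1 = 1" by (auto simp: monics_def)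
  have "f = [:-(- coeff f 0), 1:]"
  proof (rule poly_eqI)
    fix i show "coeff f i = coeff [:-(- coeff f 0), 1:] i"
      using f coeff_eq_0[of f i] by (auto simp: coeff_pCons split: nat.splits)
  qed
  thus "f \<in> range (\<lambda>a. [:-a, 1:])" by blast
qed (auto simp: monics_def)

lemma monics_mult:
  assumes "F \<in> monics m" "G \<in> monics n"
  shows "F * G \<in> monics (m + n)"
proof -
  have "lead_coeff (F * G) = 1"
    unfolding lead_coeff_mult using monicsD(2)[OF assms(1)] monicsD(2)[OF assms(2)] by simp
  moreover have "degree (F * G) = m + n"
    using monicsD[OF assms(1)] monicsD[OF assms(2)] by (simp add: degree_mult_eq)
  ultimately show ?thesis by (simp add: monics_def)
qed

lemma monics_power:
  assumes "F \<in> monics m"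
  shows "F ^ j \<in> monics (j * m)"
proof -
  have "lead_coeff (F ^ j) = 1"
    unfolding lead_coeff_power using monicsD(2)[OF assms] by simp
  moreover have "degree (F ^ j) = j * m"
    using monicsD[OF assms] by (simp add: degree_power_eq)
  ultimately show ?thesis by (simp add: monics_def)
qed

lemma monics_cofactor:
  assumes "F * G \<in> monics n" "F \<in> monics m"
  shows "G \<in> monics (n - m)" "m \<le> n"
proof -
  have nz: "F \<noteq> 0" "G \<noteq> 0" using monicsD(1)[OF assms(1)] by auto
  have deg: "n = m + degree G"
    using nz monicsD(3)[OF assms(1)] monicsD(3)[OF assms(2)] by (simp add: degree_mult_eq)
  have "lead_coeff G = 1"
    using monicsD(2)[OF assms(1)] monicsD(2)[OF assms(2)] lead_coeff_mult[of F G] by simp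
  thus "G \<in> monics (n - m)" using deg by (simp add: monics_def)
  show "m \<le> n" using deg by simp
qed

section \<open>Irreducible factors and their exponents\<close>

lemma monic_irreducible_factor:
  fixes F :: "'a::finite_field poly"
  assumes "F \<in> monics n" "n > 0"
  obtains P d where "P \<in> monic_irreducibles d" "d > 0" "P dvd F"
proof -
  let ?Q = "\<lambda>d. d > 0 \<and> (\<exists>P \<in> monics d. P dvd F)"
  have "?Q n" using assms by (intro conjI bexI[of _ F]) auto
  \<comment> \<open>A monic divisor of least positive degree is irreducible: a nonconstant factor
    \<open>A\<close>, rescaled to be monic, again divides \<open>F\<close>, so minimality leaves no
    degree for \<open>B\<close>.\<close>
  define d where "d = (LEAST d. ?Q d)"
  have d: "?Q d" unfolding d_def by (rule LeastI[of ?Q, OF \<open>?Q n\<close>])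
  then obtain P where P: "P \<in> monics d" "P dvd F" "d > 0" by auto
  have min: "d \<le> e" if "?Q e" for e unfolding d_def by (rule Least_le[of ?Q, OF that])
  have "irreducible P"
  proof (rule irreducibleI)
    show "P \<noteq> 0" using P monicsD(1) by blast
    show "\<not> P dvd 1" using P monicsD[OF P(1)] by (simp add: is_unit_iff_degree)
    fix A B assume AB: "P = A * B"
    hence nz: "A \<noteq> 0" "B \<noteq> 0" using \<open>P \<noteq> 0\<close> by auto
    have deg: "degree A + degree B = d" using monicsD(3)[OF P(1)] AB nz by (simp add: degree_mult_eq)
    show "A dvd 1 \<or> B dvd 1"
    proof (cases "degree A = 0")
      case False
      let ?A = "smult (inverse (lead_coeff A)) A"
      have "?A \<in> monics (degree A)" using nz by (auto simp: monics_def)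
      moreover have "?A dvd F"
        using nz AB P(2) by (metis dvd_trans dvd_triv_left nonzero_imp_inverse_nonzero
            leading_coeff_0_iff smult_dvd_iff)
      ultimately have "d \<le> degree A" using False by (intro min) auto
      hence "degree B = 0" using deg by simp
      thus ?thesis using nz by (simp add: is_unit_iff_degree)
    qed (use nz in \<open>simp add: is_unit_iff_degree\<close>)
  qed
  hence "P \<in> monic_irreducibles d" using monicsD[OF P(1)] by (auto simp: monic_irreducibles_def)
  thus ?thesis using that P by blast
qed

lemma monic_irreducible_prime_elem:
  "P \<in> monic_irreducibles d \<Longrightarrow> prime_elem (P :: 'a::finite_field poly)"
  by (auto simp: monic_irreducibles_def intro: field_poly_irreducible_imp_prime)

lemma monic_irreducible_degree_pos:
  assumes "P \<in> monic_irreducibles d"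
  shows "d > 0"
  using assms by (auto simp: monic_irreducibles_def irreducible_def is_unit_iff_degree)

lemma monic_irreducible_dvd_imp_eq:
  fixes P Q :: "'a::finite_field poly"
  assumes "P \<in> monic_irreducibles d" "Q \<in> monic_irreducibles e" "Q dvd P"
  shows "Q = P"
proof -
  obtain R where R: "P = Q * R" using assms(3) by auto
  have "\<not> Q dvd 1" using assms(2) by (auto simp: monic_irreducibles_def irreducible_def)
  hence "R dvd 1" using assms(1) R by (auto simp: monic_irreducibles_def dest: irreducibleD)
  then obtain c where c: "R = [:c:]" by (auto simp: is_unit_poly_iff)
  hence "lead_coeff P = lead_coeff Q * c" using R by (simp add: lead_coeff_mult)
  hence "c = 1" using assms(1,2) by (auto simp: monic_irreducibles_def)
  thus ?thesis using R c by simp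
qed

text \<open>For irreducible \<open>P\<close> and nonzero \<open>F\<close> the cardinality of this
  set is the \<open>P\<close>-adic valuation of \<open>F\<close>. As a set it turns the valuation
  into a sum of indicators of \<open>P ^ j dvd F\<close>, which can be interchanged with a sum over
  \<open>F\<close>.\<close>

definition positive_exponents :: "'a::finite_field poly \<Rightarrow> 'a poly \<Rightarrow> nat set" where
  "positive_exponents P F = {j. j > 0 \<and> P ^ j dvd F}"

lemma positive_exponents_subset:
  fixes P :: "'a::finite_field poly"
  assumes "P \<in> monic_irreducibles d" "F \<in> monics n"
  shows "positive_exponents P F \<subseteq> {1..n}"
proof
  fix j assume j: "j \<in> positive_exponents P F"
  have P: "P ^ j \<in> monics (j * d)"
    using monics_power assms(1) monic_irreducibles_subset_monics by blast
  obtain G where "F = P ^ j * G" using j by (auto simp: positive_exponents_def)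
  hence "j * d \<le> n" using monics_cofactor(2)[OF _ P] assms(2) by blast
  moreover have "j \<le> j * d" using monic_irreducible_degree_pos[OF assms(1)] by simp
  ultimately have "j \<le> n" by linarith
  thus "j \<in> {1..n}" using j by (auto simp: positive_exponents_def)
qed

lemma positive_exponents_mult_same:
  fixes P :: "'a::finite_field poly"
  assumes "P \<noteq> 0"
  shows "positive_exponents P (P * G) = insert 1 (Suc ` positive_exponents P G)"
proof (intro set_eqI)
  fix j show "j \<in> positive_exponents P (P * G) \<longleftrightarrow> j \<in> insert 1 (Suc ` positive_exponents P G)"
    using assms by (cases j) (auto simp: positive_exponents_def image_iff)
qed

text \<open>Unique factorization seen through degrees. Splitting off one irreducible factor
  \<open>P\<close> raises the valuation at \<open>P\<close> by one and changes no other. The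
  separate bound \<open>N\<close> lets the cofactor, of smaller degree, be summed over the same
  range in the induction.\<close>

lemma degree_eq_sum_exponents:
  fixes F :: "'a::finite_field poly"
  assumes "F \<in> monics n" "n \<le> N"
  shows "n = (\<Sum>d=1..N. \<Sum>P\<in>monic_irreducibles d. d * card (positive_exponents P F))"
  using assms
proof (induction n arbitrary: F rule: less_induct)
  case (less n)
  show ?case
  proof (cases "n = 0")
    case True
    hence "positive_exponents P F = {}" if "P \<in> monic_irreducibles d" for P d
      using positive_exponents_subset[OF that less.prems(1)] by auto
    thus ?thesis using True by simp
  next
    case False
    obtain P d where P: "P \<in> monic_irreducibles d" "d > 0" "P dvd F"
      using monic_irreducible_factor[OF less.prems(1)] False by auto
    then obtain G where G: "F = P * G" by auto
    have Pm: "P \<in> monics d" using P monic_irreducibles_subset_monics by auto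
    have Gm: "G \<in> monics (n - d)" "d \<le> n" using monics_cofactor[of P G n d] less.prems Pm G by auto
    hence IH: "n - d = (\<Sum>e=1..N. \<Sum>Q\<in>monic_irreducibles e. e * card (positive_exponents Q G))"
      using less.IH[of "n - d" G] less.prems P(2) False by auto
    have mult: "e * card (positive_exponents Q F) =
        e * card (positive_exponents Q G) + (if e = d then if Q = P then d else 0 else 0)"
      if Q: "Q \<in> monic_irreducibles e" for Q e
    proof (cases "Q = P")
      case True
      hence "e = d" using P Q by (auto simp: monic_irreducibles_def)
      have "finite (positive_exponents P G)"
        using positive_exponents_subset[OF P(1) Gm(1)] finite_subset by blast
      moreover have "1 \<notin> Suc ` positive_exponents P G" by (auto simp: positive_exponents_def)
      ultimately have "card (positive_exponents P F) = Suc (card (positive_exponents P G))"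
        unfolding G positive_exponents_mult_same[OF monicsD(1)[OF Pm]] by (simp add: card_image)
      thus ?thesis using True \<open>e = d\<close> by simp
    next
      case False
      hence "\<not> Q dvd P" using monic_irreducible_dvd_imp_eq[OF P(1) Q] by auto
      \<comment> \<open>Since \<open>Q\<close> is prime and does not divide \<open>P\<close>, any
        power of \<open>Q\<close> dividing \<open>P * G\<close> already divides
        \<open>G\<close>.\<close>
      hence "positive_exponents Q F = positive_exponents Q G"
        using prime_power_dvd_multD[OF monic_irreducible_prime_elem[OF Q], of _ P G]
        unfolding G positive_exponents_def by (blast intro: dvd_mult)
      thus ?thesis using False by simp
    qed
    have "(\<Sum>e=1..N. \<Sum>Q\<in>monic_irreducibles e. e * card (positive_exponents Q F))
      = (\<Sum>e=1..N. \<Sum>Q\<in>monic_irreducibles e. e * card (positive_exponents Q G)) +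
        (\<Sum>e=1..N. if e = d then \<Sum>Q\<in>monic_irreducibles e. if Q = P then d else 0 else 0)"
      unfolding sum.distrib[symmetric] by (intro sum.cong refl) (simp add: mult sum.distrib)
    also have "(\<Sum>e=1..N. if e = d then \<Sum>Q\<in>monic_irreducibles e. if Q = P then d else 0 else 0) = d"
      using P Gm(2) less.prems by (simp add: finite_monic_irreducibles)
    finally show ?thesis using IH Gm(2) by simp
  qed
qed

section \<open>The Euler product as a recurrence for multiplicative functions\<close>

lemma sum_monics_dvd:
  fixes \<chi> :: "'a::finite_field poly \<Rightarrow> 'b::comm_ring_1"
  assumes mult: "\<And>F G. \<chi> (F * G) = \<chi> F * \<chi> G" and H: "H \<in> monics m"
  shows "(\<Sum>F | F \<in> monics n \<and> H dvd F. \<chi> F) =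
    (if m \<le> n then \<chi> H * (\<Sum>G\<in>monics (n - m). \<chi> G) else 0)"
proof (cases "m \<le> n")
  case True
  \<comment> \<open>Multiplication by \<open>H\<close> matches the monic cofactors of degree
    \<open>n - m\<close> with the monic multiples of \<open>H\<close>. The case \<open>m > n\<close>
    stands apart because \<open>n - m\<close> is then truncated to 0.\<close>
  have "{F. F \<in> monics n \<and> H dvd F} = (\<lambda>G. H * G) ` monics (n - m)"
    using H True monics_mult[OF H, of _ "n - m"] by (auto dest: monics_cofactor(1) elim!: dvdE)
  moreover have "inj_on (\<lambda>G. H * G) (monics (n - m))"
    using monicsD(1)[OF H] by (auto intro!: inj_onI)
  ultimately show ?thesis using True by (simp add: sum.reindex mult sum_distrib_left)
next
  case False
  hence "{F. F \<in> monics n \<and> H dvd F} = {}"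
    using H by (auto dest: monics_cofactor(2) elim!: dvdE)
  thus ?thesis using False by (simp only: if_False sum.empty)
qed

text \<open>Needed in both directions below: to move the sum over \<open>F\<close> inside, and later
  to move the sum over \<open>k\<close> outside. The range \<open>Y x\<close> depends on
  \<open>x\<close> because the irreducibles depend on the degree.\<close>

lemma sum_swap_innermost:
  fixes f :: "'a \<Rightarrow> 'b \<Rightarrow> 'c \<Rightarrow> 'd \<Rightarrow> 'e::comm_monoid_add"
  shows "(\<Sum>x\<in>X. \<Sum>y\<in>Y x. \<Sum>z\<in>Z. \<Sum>w\<in>W. f x y z w) =
    (\<Sum>w\<in>W. \<Sum>x\<in>X. \<Sum>y\<in>Y x. \<Sum>z\<in>Z. f x y z w)"
proof -
  have "(\<Sum>y\<in>Y x. \<Sum>z\<in>Z. \<Sum>w\<in>W. f x y z w) = (\<Sum>w\<in>W. \<Sum>y\<in>Y x. \<Sum>z\<in>Z. f x y z w)" for x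
    by (subst sum.swap[of _ W Z], rule sum.swap)
  thus ?thesis by (simp only: sum.swap[of _ W X])
qed

text \<open>The coefficient of \<open>t ^ k\<close> in \<open>t L'(t) / L(t)\<close> for the Euler
  product \<open>L\<close> with factors \<open>1 / (1 - \<chi> P * t ^ degree P)\<close>: the power
  \<open>P ^ j\<close> contributes \<open>degree P * \<chi> P ^ j\<close> in degree
  \<open>k = j * degree P\<close>.\<close>

definition irreducible_power_sum :: "('a::finite_field poly \<Rightarrow> 'b::comm_ring_1) \<Rightarrow> nat \<Rightarrow> 'b" where
  "irreducible_power_sum \<chi> k =
    (\<Sum>d | d dvd k. of_nat d * (\<Sum>P\<in>monic_irreducibles d. \<chi> P ^ (k div d)))"

text \<open>The coefficient form of \<open>t L'(t) = L(t) \<cdot> t (log L)'(t)\<close>.\<close>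

lemma sum_monics_recurrence:
  fixes \<chi> :: "'a::finite_field poly \<Rightarrow> 'b::comm_ring_1"
  assumes mult: "\<And>F G. \<chi> (F * G) = \<chi> F * \<chi> G" and one: "\<chi> 1 = 1"
  shows "of_nat n * (\<Sum>F\<in>monics n. \<chi> F) =
    (\<Sum>k=1..n. irreducible_power_sum \<chi> k * (\<Sum>F\<in>monics (n - k). \<chi> F))"
proof -
  define S where "S = (\<lambda>n. \<Sum>F\<in>monics n. \<chi> F)"
  have pow: "\<chi> (P ^ j) = \<chi> P ^ j" for P j
    by (induction j) (auto simp: one mult)
  \<comment> \<open>The factor \<open>n\<close> is expanded as the degree of \<open>F\<close>, with
    each valuation written as a sum of divisibility indicators.\<close>
  have deg: "of_nat n = (\<Sum>d=1..n. \<Sum>P\<in>monic_irreducibles d. of_nat d *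
      (\<Sum>j=1..n. if P ^ j dvd F then 1 else 0 :: 'b))" if F: "F \<in> monics n" for F :: "'a poly"
  proof -
    have "of_nat n = (of_nat (\<Sum>d=1..n. \<Sum>P\<in>monic_irreducibles d. d * card (positive_exponents P F)) :: 'b)"
      using degree_eq_sum_exponents[OF F order_refl] by simp
    also have "\<dots> = (\<Sum>d=1..n. \<Sum>P\<in>monic_irreducibles d. of_nat d *
        (\<Sum>j=1..n. if P ^ j dvd F then 1 else 0))"
      unfolding of_nat_sum of_nat_mult
    proof (intro sum.cong refl arg_cong2[of _ _ _ _ "(*)"])
      fix d and P :: "'a poly" assume "P \<in> monic_irreducibles d"
      hence "positive_exponents P F = {j \<in> {1..n}. P ^ j dvd F}"
        using positive_exponents_subset[of P d F n] F by (auto simp: positive_exponents_def)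
      thus "of_nat (card (positive_exponents P F)) =
          (\<Sum>j=1..n. if P ^ j dvd F then 1 else 0 :: 'b)"
        by (simp add: sum.If_cases Int_def)
    qed
    finally show ?thesis .
  qed
  have "of_nat n * S n = (\<Sum>F\<in>monics n. of_nat n * \<chi> F)"
    by (simp add: S_def sum_distrib_left)
  also have "\<dots> = (\<Sum>F\<in>monics n. \<Sum>d=1..n. \<Sum>P\<in>monic_irreducibles d. \<Sum>j=1..n.
      of_nat d * (if P ^ j dvd F then \<chi> F else 0))"
  proof (rule sum.cong)
    fix F :: "'a poly" assume "F \<in> monics n"
    show "of_nat n * \<chi> F = (\<Sum>d=1..n. \<Sum>P\<in>monic_irreducibles d. \<Sum>j=1..n.
      of_nat d * (if P ^ j dvd F then \<chi> F else 0))"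
      unfolding deg[OF \<open>F \<in> monics n\<close>] sum_distrib_right sum_distrib_left
      by (intro sum.cong refl) auto
  qed simp
  also have "\<dots> = (\<Sum>d=1..n. \<Sum>P\<in>monic_irreducibles d. \<Sum>j=1..n. \<Sum>F\<in>monics n.
      of_nat d * (if P ^ j dvd F then \<chi> F else 0))"
    by (rule sum_swap_innermost[symmetric])
  \<comment> \<open>The sum over \<open>F\<close> is evaluated by \<open>sum_monics_dvd\<close>.
    Spreading the result over \<open>k\<close>, with \<open>k = j * d\<close> the only nonzero term,
    encodes the condition \<open>j * d \<le> n\<close> and prepares the regrouping by
    \<open>k\<close>.\<close>
  also have "\<dots> = (\<Sum>d=1..n. \<Sum>P\<in>monic_irreducibles d. \<Sum>j=1..n. \<Sum>k=1..n.
      if j * d = k then of_nat d * (\<chi> P ^ j * S (n - k)) else 0)"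
  proof (intro sum.cong refl)
    fix d j and P :: "'a poly"
    assume d: "d \<in> {1..n}" and P: "P \<in> monic_irreducibles d" and j: "j \<in> {1..n}"
    have "P ^ j \<in> monics (j * d)" using monics_power P monic_irreducibles_subset_monics by blast
    hence "(\<Sum>F | F \<in> monics n \<and> P ^ j dvd F. \<chi> F) =
      (if j * d \<le> n then \<chi> P ^ j * S (n - j * d) else 0)"
      unfolding S_def pow[symmetric] by (rule sum_monics_dvd[OF mult])
    moreover have "(\<Sum>F\<in>monics n. if P ^ j dvd F then \<chi> F else 0) = (\<Sum>F | F \<in> monics n \<and> P ^ j dvd F. \<chi> F)"
      by (simp add: sum.If_cases Int_def)
    moreover have "j * d \<ge> 1" using d j by simp
    ultimately show "(\<Sum>F\<in>monics n. of_nat d * (if P ^ j dvd F then \<chi> F else 0)) =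
      (\<Sum>k=1..n. if j * d = k then of_nat d * (\<chi> P ^ j * S (n - k)) else 0)"
      by (simp add: sum_distrib_left[symmetric])
  qed
  also have "\<dots> = (\<Sum>k=1..n. \<Sum>d=1..n. \<Sum>P\<in>monic_irreducibles d. \<Sum>j=1..n.
      if j * d = k then of_nat d * (\<chi> P ^ j * S (n - k)) else 0)"
    by (rule sum_swap_innermost)
  also have "\<dots> = (\<Sum>k=1..n. irreducible_power_sum \<chi> k * S (n - k))"
  proof (intro sum.cong refl)
    fix k assume k: "k \<in> {1..n}"
    have inner: "(\<Sum>j=1..n. if j * d = k then of_nat d * (\<chi> P ^ j * S (n - k)) else 0) =
      (if d dvd k then of_nat d * \<chi> P ^ (k div d) * S (n - k) else 0)" for d and P :: "'a poly"
    proof (cases "d dvd k")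
      case True
      then obtain i where i: "k = i * d" using mult.commute by (metis dvdE)
      hence pos: "d > 0" "i > 0" using k by auto
      have "i \<le> k" using i pos by simp
      hence "i \<in> {1..n}" using k pos by auto
      moreover have "j * d = k \<longleftrightarrow> j = i" for j using i pos by auto
      ultimately show ?thesis using True i pos by (simp add: mult.assoc)
    next
      case False
      hence "j * d \<noteq> k" for j by auto
      thus ?thesis using False by simp
    qed
    have "(\<Sum>d=1..n. \<Sum>P\<in>monic_irreducibles d. \<Sum>j=1..n.
        if j * d = k then of_nat d * (\<chi> P ^ j * S (n - k)) else 0) =
      (\<Sum>d=1..n. if d dvd k then of_nat d * (\<Sum>P\<in>monic_irreducibles d. \<chi> P ^ (k div d)) * S (n - k) else 0)"
      unfolding inner by (intro sum.cong refl) (auto simp: sum_distrib_left sum_distrib_right)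
    also have "\<dots> = (\<Sum>d | d dvd k. of_nat d * (\<Sum>P\<in>monic_irreducibles d. \<chi> P ^ (k div d)) * S (n - k))"
    proof (rule sum.mono_neutral_cong_right)
      show "{d. d dvd k} \<subseteq> {1..n}"
        using k by (fastforce dest: dvd_imp_le simp: Suc_le_eq intro: dvd_pos_nat)
    qed auto
    finally show "(\<Sum>d=1..n. \<Sum>P\<in>monic_irreducibles d. \<Sum>j=1..n.
        if j * d = k then of_nat d * (\<chi> P ^ j * S (n - k)) else 0) =
      irreducible_power_sum \<chi> k * S (n - k)"
      by (simp add: irreducible_power_sum_def sum_distrib_right)
  qed
  finally show ?thesis by (simp add: S_def)
qed

section \<open>The quadratic character\<close>

text \<open>Integer values are essential: sums of \<open>quad_symbol\<close> in the field would
  determine the counts only modulo the characteristic.\<close>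

definition quad_char :: "'a::finite_field \<Rightarrow> int" where
  "quad_char a = (if a = 0 then 0 else if quad_symbol a = 1 then 1 else -1)"

lemma quad_symbol_mult: "quad_symbol (a * b) = quad_symbol a * quad_symbol b"
  by (simp add: quad_symbol_def power_mult_distrib)

lemma quad_char_mult:
  fixes a b :: "'a::finite_field"
  assumes "odd (CARD('a))"
  shows "quad_char (a * b) = quad_char a * quad_char b"
  using quad_symbol_cases[OF assms, of a] quad_symbol_cases[OF assms, of b]
    one_neq_minus_one[OF assms]
  by (cases "a = 0"; cases "b = 0") (auto simp: quad_char_def quad_symbol_mult)

lemma quad_char_1 [simp]: "quad_char 1 = 1"
  by (simp add: quad_char_def quad_symbol_def)

lemma card_finite_field_ge_2: "CARD('a::finite_field) \<ge> 2"
proof -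
  have "card {0, 1 :: 'a} \<le> CARD('a)" by (rule card_mono) auto
  thus ?thesis by simp
qed

lemma quad_symbol_0:
  assumes "odd (CARD('a))"
  shows "quad_symbol (0 :: 'a::finite_field) = 0"
proof -
  have "CARD('a) \<ge> 3" using card_finite_field_ge_2[where ?'a = 'a] assms
    by (cases "CARD('a) = 2") auto
  thus ?thesis by (simp add: quad_symbol_def)
qed

lemma quad_char_eq_1_iff:
  fixes a :: "'a::finite_field"
  assumes "odd (CARD('a))"
  shows "quad_char a = 1 \<longleftrightarrow> quad_symbol a = 1"
  using quad_symbol_0[OF assms] by (auto simp: quad_char_def)

lemma quad_char_eq_minus_1_iff:
  fixes a :: "'a::finite_field"
  assumes "odd (CARD('a))"
  shows "quad_char a = -1 \<longleftrightarrow> quad_symbol a = -1"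
  using quad_symbol_0[OF assms] quad_symbol_cases[OF assms, of a] one_neq_minus_one[OF assms]
  by (auto simp: quad_char_def)

text \<open>The polynomial \<open>x ^ ((q - 1) / 2) - 1\<close> has at most
  \<open>(q - 1) / 2\<close> roots, fewer than the \<open>q - 1\<close> nonzero elements.\<close>

lemma exists_quad_nonresidue:
  assumes "odd (CARD('a))"
  obtains g :: "'a::finite_field" where "quad_char g = -1"
proof -
  let ?m = "(CARD('a) - 1) div 2"
  let ?p = "monom 1 ?m - 1 :: 'a poly"
  have c3: "CARD('a) \<ge> 3" using card_finite_field_ge_2[where ?'a = 'a] assms
    by (cases "CARD('a) = 2") auto
  have "coeff ?p ?m = 1" using c3 by (simp add: coeff_1)
  hence nz: "?p \<noteq> 0" by (metis coeff_0 zero_neq_one)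
  have "degree ?p \<le> ?m" by (intro degree_diff_le degree_monom_le) auto
  hence "card {x. poly ?p x = 0} \<le> ?m" using card_poly_roots_bound[OF nz] by simp
  moreover have "?m < card (UNIV - {0 :: 'a})" using c3 by (simp add: card_Diff_subset)
  ultimately have "\<not> UNIV - {0 :: 'a} \<subseteq> {x. poly ?p x = 0}"
    using card_mono[of "{x. poly ?p x = 0}" "UNIV - {0 :: 'a}"] by auto
  then obtain g :: 'a where "g \<noteq> 0" "poly ?p g \<noteq> 0" by auto
  hence "quad_char g = -1" by (simp add: quad_char_def quad_symbol_def poly_monom)
  thus ?thesis by (rule that)
qed

text \<open>Multiplication by a nonresidue permutes the field and negates the sum.\<close>

lemma sum_quad_char:
  assumes "odd (CARD('a))"
  shows "(\<Sum>x\<in>(UNIV :: 'a::finite_field set). quad_char x) = 0"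
proof -
  obtain g :: 'a where g: "quad_char g = -1" using exists_quad_nonresidue[OF assms] .
  hence "g \<noteq> 0" by (auto simp: quad_char_def)
  have "bij (\<lambda>x. g * x)"
    by (rule bij_betwI[of _ _ _ "\<lambda>x. inverse g * x"]) (use \<open>g \<noteq> 0\<close> in \<open>auto simp: field_simps\<close>)
  hence "(\<Sum>x\<in>(UNIV :: 'a set). quad_char x) = (\<Sum>x\<in>(UNIV :: 'a set). quad_char (g * x))"
    using sum.reindex_bij_betw[of "\<lambda>x. g * x" UNIV UNIV quad_char] by simp
  also have "\<dots> = - (\<Sum>x\<in>(UNIV :: 'a set). quad_char x)"
    by (simp add: quad_char_mult[OF assms] g sum_negf)
  finally show ?thesis by simp
qed

section \<open>Character sums over monic polynomials of each degree\<close>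

definition poly_char :: "'a::finite_field \<Rightarrow> 'a \<Rightarrow> 'a poly \<Rightarrow> int" where
  "poly_char u v F = quad_char (poly F u * poly F v)"

lemma poly_char_mult:
  fixes u v :: "'a::finite_field"
  assumes "odd (CARD('a))"
  shows "poly_char u v (F * G) = poly_char u v F * poly_char u v G"
  by (simp add: poly_char_def quad_char_mult[OF assms])

lemma poly_char_1: "poly_char u v 1 = 1"
  by (simp add: poly_char_def)

text \<open>For \<open>a \<noteq> v\<close>, dividing \<open>(u - a) * (v - a)\<close> by the square
  of \<open>v - a\<close> leaves \<open>1 + (u - v) / (v - a)\<close>, which takes every value
  except 1 exactly once. The full character sum is 0, so omitting \<open>quad_char 1\<close> gives
  -1.\<close>

lemma sum_monics_1_poly_char:
  fixes u v :: "'a::finite_field"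
  assumes odd: "odd (CARD('a))" and "u \<noteq> v"
  shows "(\<Sum>F\<in>monics 1. poly_char u v F) = -1"
proof -
  have eq: "quad_char ((u - a) * (v - a)) = quad_char (1 + (u - v) / (v - a))" if "a \<noteq> v" for a
  proof -
    have "(u - a) * (v - a) = (1 + (u - v) / (v - a)) * ((v - a) * (v - a))"
      using that by (simp add: field_simps)
    moreover have "quad_char (v - a) * quad_char (v - a) = 1"
      using that by (auto simp: quad_char_def)
    ultimately show ?thesis by (simp only: quad_char_mult[OF odd] mult_1_right)
  qed
  \<comment> \<open>The inverse comes from solving \<open>y = 1 + (u - v) / (v - a)\<close> for
    \<open>a\<close>.\<close>
  have bij: "bij_betw (\<lambda>a. 1 + (u - v) / (v - a)) (UNIV - {v}) (UNIV - {1})"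
    by (rule bij_betwI[of _ _ _ "\<lambda>y. v - (u - v) / (y - 1)"]) (use assms(2) in auto)
  have "(\<Sum>F\<in>monics 1. poly_char u v F) = (\<Sum>a\<in>UNIV. quad_char ((u - a) * (v - a)))"
    unfolding monics_1 by (subst sum.reindex) (auto simp: inj_on_def poly_char_def)
  also have "\<dots> = (\<Sum>a\<in>UNIV - {v}. quad_char ((u - a) * (v - a)))"
    by (rule sum.mono_neutral_right) (auto simp: quad_char_def)
  also have "\<dots> = (\<Sum>a\<in>UNIV - {v}. quad_char (1 + (u - v) / (v - a)))"
    by (intro sum.cong) (auto simp: eq)
  also have "\<dots> = (\<Sum>y\<in>UNIV - {1 :: 'a}. quad_char y)"
    by (rule sum.reindex_bij_betw[OF bij])
  also have "\<dots> = -1"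
    using sum_quad_char[OF odd] by (simp add: sum_diff1)
  finally show ?thesis .
qed

text \<open>
  Adding a multiple of \<open>x - v\<close> scales \<open>F(u)\<close> by a nonresidue without changing \<open>F(v)\<close>; for
  degree at least \<open>2\<close> this permutes the monic polynomials and flips the sign of the character.
\<close>

lemma sum_monics_poly_char_eq_0:
  fixes u v :: "'a::finite_field"
  assumes odd: "odd (CARD('a))" and "u \<noteq> v" and n: "n \<ge> 2"
  shows "(\<Sum>F\<in>monics n. poly_char u v F) = 0"
proof -
  obtain g :: 'a where g: "quad_char g = -1" using exists_quad_nonresidue[OF odd] .
  hence "g \<noteq> 0" by (auto simp: quad_char_def)
  \<comment> \<open>At \<open>u\<close> the factor \<open>x - v\<close> equals \<open>u - v\<close>,
    so this coefficient adds exactly \<open>(g - 1) * poly F u\<close>.\<close>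
  define \<phi> where "\<phi> F = F + smult ((g - 1) * poly F u / (u - v)) [:-v, 1:]" for F
  have u: "poly (\<phi> F) u = g * poly F u" and v: "poly (\<phi> F) v = poly F v" for F
  proof -
    have "poly (\<phi> F) u = poly F u + (g - 1) * poly F u / (u - v) * (u - v)"
      by (simp only: \<phi>_def poly_add poly_smult) simp
    also have "\<dots> = poly F u + (g - 1) * poly F u" using \<open>u \<noteq> v\<close> by simp
    finally show "poly (\<phi> F) u = g * poly F u" by (simp add: algebra_simps)
  qed (simp add: \<phi>_def)
  have into: "\<phi> ` monics n \<subseteq> monics n"
  proof safe
    fix F :: "'a poly" assume F: "F \<in> monics n"
    let ?r = "smult ((g - 1) * poly F u / (u - v)) [:-v, 1:]"
    have "degree ?r \<le> 1" by (rule order.trans[OF degree_smult_le]) simp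
    hence r: "degree ?r < n" using n by linarith
    hence "degree (\<phi> F) = n" "coeff (\<phi> F) n = coeff F n"
      using monicsD(3)[OF F] coeff_eq_0[OF r]
      by (simp_all only: \<phi>_def degree_add_eq_left coeff_add add_0_right)
    thus "\<phi> F \<in> monics n" using monicsD[OF F] by (simp add: monics_def)
  qed
  \<comment> \<open>As \<open>g\<close> is nonzero, the image determines \<open>poly F u\<close>,
    hence the correction term, hence \<open>F\<close>.\<close>
  have inj: "inj_on \<phi> (monics n)"
  proof (rule inj_onI)
    fix F G assume eq: "\<phi> F = \<phi> G"
    hence "poly F u = poly G u" using u[of F] u[of G] \<open>g \<noteq> 0\<close> by simp
    thus "F = G" using eq by (simp add: \<phi>_def)
  qed
  hence "bij_betw \<phi> (monics n) (monics n)"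
    using endo_inj_surj[OF finite_monics into inj] by (simp add: bij_betw_def)
  hence "(\<Sum>F\<in>monics n. poly_char u v F) = (\<Sum>F\<in>monics n. poly_char u v (\<phi> F))"
    by (rule sum.reindex_bij_betw[symmetric])
  also have "\<dots> = - (\<Sum>F\<in>monics n. poly_char u v F)"
    by (simp add: poly_char_def u v quad_char_mult[OF odd] g sum_negf)
  finally show ?thesis by simp
qed

text \<open>In the recurrence only the monic sums of degree 0 and 1, namely 1 and -1, survive on the
  right. For \<open>n = 1\<close> it gives the value -1, and for larger \<open>n\<close> it says
  that consecutive values agree.\<close>

lemma irreducible_power_sum_poly_char:
  fixes u v :: "'a::finite_field"
  assumes odd: "odd (CARD('a))" and "u \<noteq> v" and "n \<ge> 1"
  shows "irreducible_power_sum (poly_char u v) n = -1"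
  using assms(3)
proof (induction n rule: less_induct)
  case (less n)
  let ?S = "\<lambda>n. \<Sum>F\<in>monics n. poly_char u v F"
  let ?L = "irreducible_power_sum (poly_char u v)"
  have S0: "?S 0 = 1" by (simp add: monics_0 poly_char_1)
  note S1 = sum_monics_1_poly_char[OF assms(1,2)]
  note S2 = sum_monics_poly_char_eq_0[OF assms(1,2)]
  have rec: "int n * ?S n = (\<Sum>k=1..n. ?L k * ?S (n - k))"
    using sum_monics_recurrence[of "poly_char u v" n, OF poly_char_mult[OF odd]] by (simp add: poly_char_1)
  show ?case
  proof (cases "n = 1")
    case True
    thus ?thesis using rec S0 S1 by simp
  next
    case False
    then obtain m where m: "n = Suc m" "m \<ge> 1" using less.prems by (cases n) auto
    have "(\<Sum>k=1..n. ?L k * ?S (n - k)) = (\<Sum>k\<in>{m, n}. ?L k * ?S (n - k))"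
    proof (rule sum.mono_neutral_right)
      show "\<forall>k\<in>{1..n} - {m, n}. ?L k * ?S (n - k) = 0"
        using m S2 by auto
    qed (use m in auto)
    also have "\<dots> = ?L n - ?L m" using m S0 S1 by simp
    finally have "?L n = ?L m" using rec S2[of n] m by simp
    thus ?thesis using less.IH[of m] m by simp
  qed
qed

section \<open>Inversion\<close>

text \<open>Strong induction replaces Moebius inversion: the proper divisors contribute nothing, so
  \<open>n * f n = 0\<close>.\<close>

lemma divisor_sum_eq_0_imp:
  fixes f :: "nat \<Rightarrow> int"
  assumes "\<And>n. n \<ge> 1 \<Longrightarrow> (\<Sum>d | d dvd n. int d * f d) = 0" and "n \<ge> 1"
  shows "f n = 0"
  using assms(2)
proof (induction n rule: less_induct)
  case (less n)
  have "(\<Sum>d | d dvd n. int d * f d) = (\<Sum>d\<in>{n}. int d * f d)"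
  proof (rule sum.mono_neutral_right)
    show "\<forall>d\<in>{d. d dvd n} - {n}. int d * f d = 0"
    proof
      fix d assume "d \<in> {d. d dvd n} - {n}"
      hence "d < n" "d \<ge> 1" using less.prems
        by (auto simp: le_neq_implies_less dvd_imp_le intro: Suc_leI dvd_pos_nat)
      thus "int d * f d = 0" using less.IH by simp
    qed
  qed (use less.prems in \<open>auto intro: finite_divisors_nat\<close>)
  thus ?case using assms(1)[OF less.prems] less.prems by simp
qed

text \<open>Substituting \<open>d = 2 * e\<close> turns half-index terms into terms indexed by
  divisors of \<open>n\<close>, so that they can be merged with the other divisor sums.\<close>

lemma sum_divisors_even:
  fixes f :: "nat \<Rightarrow> int"
  assumes "n \<ge> 1"
  shows "(\<Sum>d | d dvd n. if even d then int d * f (d div 2) else 0) =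
    (\<Sum>e | e dvd n. if even (n div e) then 2 * int e * f e else 0)"
proof -
  have fin: "finite {d. d dvd n}" using assms by (intro finite_divisors_nat) auto
  have "(\<Sum>d | d dvd n. if even d then int d * f (d div 2) else 0) =
      (\<Sum>d | d dvd n \<and> even d. int d * f (d div 2))"
    using fin by (simp add: sum.If_cases Int_def)
  also have "\<dots> = (\<Sum>e | e dvd n \<and> even (n div e). 2 * int e * f e)"
    by (rule sum.reindex_bij_witness[of _ "\<lambda>e. 2 * e" "\<lambda>d. d div 2"])
      (use assms in \<open>auto elim!: dvdE\<close>)
  also have "\<dots> = (\<Sum>e | e dvd n. if even (n div e) then 2 * int e * f e else 0)"
    using fin by (simp add: sum.If_cases Int_def)
  finally show ?thesis .
qed

theorem theorem3:
  fixes u v :: "'a::finite_field" and n :: nat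
  assumes "odd (CARD('a))"
    and "u \<noteq> v"
    and "n \<ge> 2"
  shows "int (card (C_set u v n)) - int (card (D_set u v n)) =
    (if even n then int (card (C_set u v (n div 2))) else 0)"
proof -
  define B where "B d = int (card {P \<in> monic_irreducibles d. poly_char u v P = 1})" for d
  define C where "C d = int (card {P \<in> monic_irreducibles d. poly_char u v P = -1})" for d
  have C: "C d = int (card (C_set u v d))" for d
    by (simp add: C_def C_set_def poly_char_def quad_char_eq_minus_1_iff[OF assms(1)])
  \<comment> \<open>The degree bound matters: in degree 1 the set \<open>D_set\<close> also contains
    \<open>x - u\<close> and \<open>x - v\<close>, where the character is 0.\<close>
  have D: "B n = int (card (D_set u v n))"
    by (simp add: B_def D_set_eq[OF assms(1,3)] poly_char_def quad_char_eq_1_iff[OF assms(1)])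
  \<comment> \<open>A positive exponent ensures that irreducibles with character 0 contribute
    nothing.\<close>
  have pow: "(\<Sum>P\<in>monic_irreducibles d. poly_char u v P ^ k) = B d + (-1) ^ k * C d" if "k > 0" for d k
  proof -
    have "(\<Sum>P\<in>monic_irreducibles d. poly_char u v P ^ k) =
      (\<Sum>P\<in>monic_irreducibles d. (if poly_char u v P = 1 then 1 else 0) +
        (-1) ^ k * (if poly_char u v P = -1 then 1 else 0))"
      using that by (intro sum.cong refl) (auto simp: poly_char_def quad_char_def)
    thus ?thesis
      by (simp add: sum.distrib sum_distrib_left[symmetric] sum.If_cases
          finite_monic_irreducibles B_def C_def Int_def)
  qed
  \<comment> \<open>The claim is \<open>E n = 0\<close>. The extra 1 at \<open>d = 1\<close> cancels
    the constant -1 of the divisor sums and is absent for \<open>n \<ge> 2\<close>.\<close>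
  define E where "E d = B d - C d + (if even d then C (d div 2) else 0) + (if d = 1 then 1 else 0)" for d
  have "(\<Sum>d | d dvd m. int d * E d) = 0" if m: "m \<ge> 1" for m
  proof -
    have fin: "finite {d. d dvd m}" using m by (intro finite_divisors_nat) auto
    have "(\<Sum>d | d dvd m. int d * E d) =
      (\<Sum>d | d dvd m. int d * (B d - C d)) +
      (\<Sum>d | d dvd m. if even d then int d * C (d div 2) else 0) +
      (\<Sum>d | d dvd m. if d = 1 then 1 else 0)"
      unfolding sum.distrib[symmetric] by (intro sum.cong refl) (auto simp: E_def algebra_simps)
    also have "(\<Sum>d | d dvd m. if d = 1 then 1 else 0 :: int) = 1"
      using fin by simp
    also note sum_divisors_even[OF m]
    \<comment> \<open>The coefficient of \<open>C d\<close> is -1, raised by 2 when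
      \<open>m div d\<close> is even, which is \<open>(-1) ^ (m div d)\<close>.\<close>
    also have "(\<Sum>d | d dvd m. int d * (B d - C d)) +
        (\<Sum>d | d dvd m. if even (m div d) then 2 * int d * C d else 0) =
        (\<Sum>d | d dvd m. int d * (B d + (-1) ^ (m div d) * C d))"
      unfolding sum.distrib[symmetric] by (intro sum.cong refl) (auto simp: algebra_simps)
    also have "\<dots> = irreducible_power_sum (poly_char u v) m"
      unfolding irreducible_power_sum_def
      using m by (intro sum.cong refl) (auto simp: pow elim!: dvdE)
    finally show ?thesis using irreducible_power_sum_poly_char[OF assms(1,2) m] by simp
  qed
  hence "E n = 0" using divisor_sum_eq_0_imp[of E n] assms(3) by simp
  thus ?thesis using assms(3) by (auto simp: E_def C D)
qed

end
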